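(* Let $S$ be a free semigroup and let $T$ be a free subsemigroup of $S$. Then $T$ is separator including, that is, $\mathrm{Sep}T\subseteq T$.
   Context: For a subset $A$ of a semigroup $S$, write $\overline{A}=S\setminus A$. The separator of $A$, denoted $\mathrm{Sep}A$, is the set of all $x\in S$ such that $xA\subseteq A$, $Ax\subseteq A$, $x\overline{A}\subseteq\overline{A}$ and $\overline{A}x\subseteq\overline{A}$. A subset $A$ of $S$ is called separator including if $\mathrm{Sep}A\subseteq A$. A free semigroup is a semigroup isomorphic to the semigroup of all non-empty finite words over some non-empty alphabet under concatenation (no identity element). A free subsemigroup of $S$ is a (non-empty) subsemigroup of $S$ that is itself a free semigroup. *)

theory Defs
  imports Main
begin

definition nonempty_words :: "'b set \<Rightarrow> 'b list set" where
  "nonempty_words X = lists X - {[]}"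

definition word_isomorphism :: "('b list \<Rightarrow> 'a::semigroup_mult) \<Rightarrow> 'b set \<Rightarrow> 'a set \<Rightarrow> bool" where
  "word_isomorphism \<phi> X S \<longleftrightarrow>
     bij_betw \<phi> (nonempty_words X) S \<and>
     (\<forall>u\<in>nonempty_words X. \<forall>v\<in>nonempty_words X. \<phi> (u @ v) = \<phi> u * \<phi> v)"

definition subsemigroup :: "'a::semigroup_mult set \<Rightarrow> bool" where
  "subsemigroup T \<longleftrightarrow> T \<noteq> {} \<and> (\<forall>x\<in>T. \<forall>y\<in>T. x * y \<in> T)"

text \<open>
  Here \<open>S\<close> may be \<open>UNIV\<close> or a proper subset of the ambient semigroup. HOL cannot quantify over
  the type of the alphabet; taking its letters from \<open>'a\<close> is no restriction, as the lemma
  \<open>free_semigroupI\<close> shows.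
\<close>
definition free_semigroup :: "'a::semigroup_mult set \<Rightarrow> bool" where
  "free_semigroup S \<longleftrightarrow>
     subsemigroup S \<and> (\<exists>(X :: 'a set) \<phi>. X \<noteq> {} \<and> word_isomorphism \<phi> X S)"

lemma free_semigroupI:
  fixes X :: "'b set" and S :: "'a::semigroup_mult set"
  assumes X: "X \<noteq> {}" and iso: "word_isomorphism \<phi> X S"
  shows "free_semigroup S"
proof -
  have bij: "bij_betw \<phi> (nonempty_words X) S"
    and hom: "\<And>u v. u \<in> nonempty_words X \<Longrightarrow> v \<in> nonempty_words X \<Longrightarrow> \<phi> (u @ v) = \<phi> u * \<phi> v"
    using iso by (auto simp: word_isomorphism_def)
  have img: "\<phi> ` nonempty_words X = S"
    using bij by (rule bij_betw_imp_surj_on)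
  have app: "u @ v \<in> nonempty_words X" if "u \<in> nonempty_words X" "v \<in> nonempty_words X" for u v
    using that by (auto simp: nonempty_words_def)
  obtain x where "x \<in> X" using X by blast
  then have "[x] \<in> nonempty_words X" by (simp add: nonempty_words_def)
  then have "S \<noteq> {}" using img by blast
  moreover have "\<forall>a\<in>S. \<forall>b\<in>S. a * b \<in> S"
    using hom app by (auto simp flip: img) (metis image_eqI)
  ultimately have sub: "subsemigroup S" by (simp add: subsemigroup_def)
  define e where "e x = \<phi> [x]" for x
  have e: "inj_on e X"
  proof (rule inj_onI)
    fix x y assume "x \<in> X" "y \<in> X" "e x = e y"
    then have "[x] = [y]"
      using bij by (auto simp: e_def nonempty_words_def dest!: bij_betw_imp_inj_on inj_onD)
    then show "x = y" by simp
  qed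
  define d where "d = inv_into X e"
  have d: "bij_betw d (e ` X) X"
    unfolding d_def using e by (simp add: bij_betw_inv_into inj_on_imp_bij_betw)
  have "bij_betw (map d) (lists (e ` X)) (lists X)"
    using d by (rule bij_lists)
  then have md: "bij_betw (map d) (nonempty_words (e ` X)) (nonempty_words X)"
    unfolding nonempty_words_def by (rule bij_betw_DiffI) auto
  then have "bij_betw (\<phi> \<circ> map d) (nonempty_words (e ` X)) S"
    using bij by (rule bij_betw_trans)
  moreover have "map d u \<in> nonempty_words X" if "u \<in> nonempty_words (e ` X)" for u
    using bij_betw_apply[OF md that] .
  ultimately have "word_isomorphism (\<phi> \<circ> map d) (e ` X) S"
    using hom by (simp add: word_isomorphism_def)
  then show ?thesis
    using sub X unfolding free_semigroup_def
    by (intro conjI exI[of _ "e ` X"] exI[of _ "\<phi> \<circ> map d"]) auto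
qed

definition separator :: "'a::semigroup_mult set \<Rightarrow> 'a set" where
  "separator A = {x. (\<lambda>a. x * a) ` A \<subseteq> A \<and> (\<lambda>a. a * x) ` A \<subseteq> A \<and>
                     (\<lambda>a. x * a) ` (- A) \<subseteq> - A \<and> (\<lambda>a. a * x) ` (- A) \<subseteq> - A}"

definition separator_including :: "'a::semigroup_mult set \<Rightarrow> bool" where
  "separator_including A \<longleftrightarrow> separator A \<subseteq> A"

end

theory Submission
  imports Defs
begin

text \<open>
  For \<open>x \<in> Sep T\<close> and \<open>t \<in> T\<close>, both \<open>x t\<close> and \<open>t x\<close> lie in \<open>T\<close>, and \<open>t (x t) = (t x) t\<close>.
  Factor both sides over the free generators of \<open>T\<close>: the word for \<open>t x\<close> properly extends the
  word for \<open>t\<close>, since no element of \<open>S\<close> is fixed by a right multiplication. So \<open>t x = t z\<close> for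
  some \<open>z \<in> T\<close>, and cancelling \<open>t\<close> in \<open>S\<close> gives \<open>x = z\<close>.
\<close>

lemma nonempty_words_append:
  "u \<in> nonempty_words X \<Longrightarrow> v \<in> nonempty_words X \<Longrightarrow> u @ v \<in> nonempty_words X"
  by (auto simp: nonempty_words_def)

lemma word_isomorphism_obtain:
  assumes "word_isomorphism \<phi> X S" "s \<in> S"
  obtains w where "w \<in> nonempty_words X" "\<phi> w = s"
  using assms unfolding word_isomorphism_def bij_betw_def by auto

lemma word_isomorphism_append:
  "word_isomorphism \<phi> X S \<Longrightarrow> u \<in> nonempty_words X \<Longrightarrow> v \<in> nonempty_words X \<Longrightarrow>
    \<phi> (u @ v) = \<phi> u * \<phi> v"
  by (simp add: word_isomorphism_def)

lemma word_isomorphism_mem: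
  "word_isomorphism \<phi> X S \<Longrightarrow> w \<in> nonempty_words X \<Longrightarrow> \<phi> w \<in> S"
  unfolding word_isomorphism_def by (blast dest: bij_betwE)

lemma word_isomorphism_eqD:
  "word_isomorphism \<phi> X S \<Longrightarrow> \<phi> u = \<phi> v \<Longrightarrow>
    u \<in> nonempty_words X \<Longrightarrow> v \<in> nonempty_words X \<Longrightarrow> u = v"
  unfolding word_isomorphism_def by (blast dest: bij_betw_imp_inj_on inj_onD)

text \<open>Words over the generators cancel on the left, and injectivity of \<open>\<phi>\<close>
  carries this over to \<open>S\<close>.\<close>

lemma free_semigroup_left_cancel:
  assumes "free_semigroup S" "a \<in> S" "b \<in> S" "c \<in> S" and eq: "a * b = a * c"
  shows "b = c"
proof -
  obtain X :: "'a set" and \<phi> where iso: "word_isomorphism \<phi> X S"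
    using assms(1) unfolding free_semigroup_def by blast
  obtain u v w where uvw: "u \<in> nonempty_words X" "v \<in> nonempty_words X" "w \<in> nonempty_words X"
    and \<phi>: "\<phi> u = a" "\<phi> v = b" "\<phi> w = c"
    using assms(2-4) word_isomorphism_obtain[OF iso] by metis
  have "\<phi> (u @ v) = \<phi> (u @ w)"
    using eq \<phi> uvw by (simp add: word_isomorphism_append[OF iso])
  then have "u @ v = u @ w"
    by (rule word_isomorphism_eqD[OF iso]) (simp_all add: nonempty_words_append uvw)
  then show ?thesis using \<phi> by simp
qed

text \<open>The word of \<open>b\<close> is non-empty, so appending it to the word of
  \<open>a\<close> makes a strictly longer word.\<close>

lemma free_semigroup_mult_neq:
  assumes "free_semigroup S" "a \<in> S" "b \<in> S"
  shows "a * b \<noteq> a"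
proof
  assume eq: "a * b = a"
  obtain X :: "'a set" and \<phi> where iso: "word_isomorphism \<phi> X S"
    using assms(1) unfolding free_semigroup_def by blast
  obtain u v where uv: "u \<in> nonempty_words X" "v \<in> nonempty_words X"
    and \<phi>: "\<phi> u = a" "\<phi> v = b"
    using assms(2,3) word_isomorphism_obtain[OF iso] by metis
  have "\<phi> (u @ v) = \<phi> u"
    using eq \<phi> uv by (simp add: word_isomorphism_append[OF iso])
  then have "u @ v = u"
    by (rule word_isomorphism_eqD[OF iso]) (simp_all add: nonempty_words_append uv)
  then show False using uv by (simp add: nonempty_words_def)
qed

lemma free_subsemigroup_conjugator:
  fixes T :: "'a::semigroup_mult set"
  assumes S: "free_semigroup (UNIV :: 'a set)" and T: "free_semigroup T"
    and t: "t \<in> T" and tx: "t * x \<in> T" and xt: "x * t \<in> T"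
  shows "x \<in> T"
proof -
  obtain X :: "'a set" and \<phi> where iso: "word_isomorphism \<phi> X T"
    using T unfolding free_semigroup_def by blast
  note app = word_isomorphism_append[OF iso]
  obtain p q r where pqr: "p \<in> nonempty_words X" "q \<in> nonempty_words X" "r \<in> nonempty_words X"
    and \<phi>: "\<phi> p = t" "\<phi> q = x * t" "\<phi> r = t * x"
    using t tx xt word_isomorphism_obtain[OF iso] by metis
  have "\<phi> (p @ q) = \<phi> (r @ p)"
    using \<phi> pqr by (simp add: app mult.assoc)
  then have "p @ q = r @ p"
    by (rule word_isomorphism_eqD[OF iso]) (simp_all add: nonempty_words_append pqr)
  \<comment> \<open>Both \<open>p\<close> and \<open>r\<close> are prefixes of one word, so one is a
    prefix of the other. The case \<open>r = p\<close> falls under the second alternative, with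
    \<open>y = []\<close>.\<close>
  then consider z where "r = p @ z" "z \<noteq> []" | y where "p = r @ y"
    by (metis append_eq_append_conv2 append_Nil2)
  then show ?thesis
  proof cases
    case 1
    then have z: "z \<in> nonempty_words X"
      using pqr by (auto simp: nonempty_words_def)
    then have "t * x = t * \<phi> z"
      using 1 \<phi> pqr app by metis
    \<comment> \<open>The cancellation takes place in \<open>S\<close>, because \<open>x\<close> is
      not yet known to lie in \<open>T\<close>.\<close>
    then have "x = \<phi> z"
      by (rule free_semigroup_left_cancel[OF S UNIV_I UNIV_I UNIV_I])
    then show ?thesis using word_isomorphism_mem[OF iso z] by simp
  next
    case 2
    \<comment> \<open>If \<open>y\<close> were empty, then \<open>p = r\<close> and hence
      \<open>t = t * x\<close>, so right multiplication by \<open>x\<close> would fix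
      \<open>t\<close>.\<close>
    have "y \<noteq> []"
      using 2 \<phi> free_semigroup_mult_neq[OF S UNIV_I UNIV_I, of t x] by (metis append_Nil2)
    then have "y \<in> nonempty_words X"
      using 2 pqr by (auto simp: nonempty_words_def)
    \<comment> \<open>Now \<open>t\<close> would be fixed by right multiplication by
      \<open>x * \<phi> y\<close>, so this case cannot occur.\<close>
    then have "\<phi> p = \<phi> r * \<phi> y"
      unfolding 2 by (rule app[OF pqr(3)])
    then have "t * (x * \<phi> y) = t"
      unfolding \<phi> mult.assoc by (rule sym)
    with free_semigroup_mult_neq[OF S UNIV_I UNIV_I] show ?thesis by (rule notE)
  qed
qed

theorem theorem11:
  fixes T :: "'a::semigroup_mult set"
  assumes "free_semigroup (UNIV :: 'a set)"
    and "subsemigroup T"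
    and "free_semigroup T"
  shows "separator_including T"
  unfolding separator_including_def
proof
  fix x assume x: "x \<in> separator T"
  \<comment> \<open>Any element of \<open>T\<close> will do: \<open>x\<close> in the separator puts
    both of its products with \<open>x\<close> into \<open>T\<close>.\<close>
  obtain t where t: "t \<in> T"
    using assms(2) by (auto simp: subsemigroup_def)
  show "x \<in> T"
    proof (rule free_subsemigroup_conjugator[OF assms(1,3) t])
    show "t * x \<in> T" "x * t \<in> T"
      using x t by (auto simp: separator_def)
  qed
qed

end
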